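(* Let $G$ be a finite abelian group, $F$ a $2$-cochain on $G$, and $s:G\to\mathbb{K}^\times$ a map with $s(e)=1$ such that the linear map $\varsigma$ on $\mathbb{K}_FG$ defined by $\varsigma(x)=s(x)x$ for $x\in G$ is a strong involution. Let $\epsilon\in\mathbb{K}$ be nonzero. Suppose the deformed group algebra $\mathbb{K}_FG$, viewed as a quasicrossed product, corresponds to the quasicrossed system $(G,\mathbb{K},\phi,\sigma,\alpha)$ for $G$ over $\mathbb{K}$, and that the algebra $\mathbb{K}_{\overline{F}}\overline{G}$, $\overline{G}=G\times\mathbb{Z}_2$, obtained from the Cayley-Dickson process (with parameter $\epsilon$ and involution $\varsigma$) applied to $\mathbb{K}_FG$ corresponds to the quasicrossed system $(\overline{G},\mathbb{K},\overline{\phi},\overline{\sigma},\overline{\alpha})$ for $\overline{G}$ over $\mathbb{K}$. Then for all $x,y\in G$, $$\overline{\alpha}(x,y)=\alpha(x,y),\qquad \overline{\alpha}(x,vy)=s(x)\,\alpha(x,y),$$ $$\overline{\alpha}(vx,y)=\alpha(y,x),\qquad \overline{\alpha}(vx,vy)=\epsilon\, s(x)\,\alpha(y,x),$$ where $x$ stands for $(x,0)\in\overline{G}$ and $vx$ stands for $(x,1)\in\overline{G}$.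
   Context: $\mathbb{K}$ is an algebraically closed field of characteristic zero; $e$ is the neutral element of $G$. A $2$-cochain on a group $\Gamma$ with neutral element $e$ is a map $F:\Gamma\times\Gamma\to\mathbb{K}^\times$ with $F(e,g)=F(g,e)=1$ for all $g$. The deformed group algebra $\mathbb{K}_F\Gamma$ is the vector space with basis $\Gamma$ and product $g\cdot h=F(g,h)\,gh$ extended bilinearly; it is graded by $\Gamma$ with $g$ of degree $g$, and is quasiassociative with cocycle $\phi(g,h,k)=\frac{F(g,h)F(gh,k)}{F(h,k)F(g,hk)}$, i.e. $(g\cdot h)\cdot k=\phi(g,h,k)\,g\cdot(h\cdot k)$. A quasicrossed system for $\Gamma$ over $\mathbb{K}$ is $(\Gamma,\mathbb{K},\phi,\sigma,\alpha)$ with maps $\sigma:\Gamma\to\mathrm{Aut}(\mathbb{K})$, $\alpha:\Gamma\times\Gamma\to\mathbb{K}^\times$ and a cocycle $\phi:\Gamma^3\to\mathbb{K}^\times$ such that $\sigma(g)(\sigma(h)(x))=\alpha(g,h)\sigma(gh)(x)\alpha(g,h)^{-1}$, $\alpha(g,h)\alpha(gh,k)=\phi(g,h,k)\sigma(g)(\alpha(h,k))\alpha(g,hk)$ and $\alpha(g,e)=\alpha(e,g)=1$ for all $g,h,k\in\Gamma$, $x\in\mathbb{K}$. The quasicrossed system to which a deformed group algebra $\mathbb{K}_F\Gamma$ corresponds is the natural one attached to the basis $\Gamma$: $\phi$ as displayed above, $\sigma(g)=\mathrm{id}$ for all $g$, and $\alpha=F$; equivalently $\alpha(g,h)$ is the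 scalar with $g\cdot h=\alpha(g,h)\,gh$. An involution of an algebra $A$ with identity $1$ is a linear map $\varsigma:A\to A$ with $\varsigma(ab)=\varsigma(b)\varsigma(a)$ and $\varsigma^2=\mathrm{id}$; it is strong if $a+\varsigma(a)\in\mathbb{K}1$ and $a\,\varsigma(a)\in\mathbb{K}1$ for all $a\in A$. The Cayley-Dickson process with nonzero parameter $\epsilon\in\mathbb{K}$ produces from $(A,\varsigma)$ the algebra $\overline{A}=A\oplus vA$ ($vA$ being a second copy of $A$, with elements written $va$) with product $(a+vb)(c+vd)=(ac+\epsilon\, d\,\varsigma(b))+v(\varsigma(a)d+cb)$. For $A=\mathbb{K}_FG$, the algebra $\overline{A}$ with its basis $\{x, vx: x\in G\}$, where $x$ and $vx$ are identified with $(x,0)$ and $(x,1)$ in $\overline{G}=G\times\mathbb{Z}_2$ ($\mathbb{Z}_2=\{0,1\}$ additive), is a deformed group algebra $\mathbb{K}_{\overline{F}}\overline{G}$ for a $2$-cochain $\overline{F}$ on $\overline{G}$. *)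

theory Defs
  imports
    "HOL-Computational_Algebra.Polynomial"
    "HOL-Library.Poly_Mapping"
    "HOL-Library.Product_Plus"
    "HOL-Library.Z2"
begin

text \<open>
  Groups are types of class \<^class>\<open>group_add\<close> and are therefore written additively: the neutral
  element $e$ is \<open>0\<close> and the product $gh$ is \<open>g + h\<close> (no commutativity is built in).
  The vector space with basis $\Gamma$ over $K$ is the type \<open>'g \<Rightarrow>\<^sub>0 'k\<close> of finitely supported
  functions. The ring multiplication that the library puts on this type (the undeformed
  convolution) is not used.
\<close>

subsection \<open>Unital algebras, not necessarily associative\<close>

locale unital_algebra = vector_space scale
  for scale :: "'k::field \<Rightarrow> 'a::ab_group_add \<Rightarrow> 'a" +
  fixes amult :: "'a \<Rightarrow> 'a \<Rightarrow> 'a" and unit :: 'a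
  assumes mult_add_left: "amult (a + b) c = amult a c + amult b c"
    and mult_add_right: "amult a (b + c) = amult a b + amult a c"
    and mult_scale_left: "amult (scale r a) b = scale r (amult a b)"
    and mult_scale_right: "amult a (scale r b) = scale r (amult a b)"
    and unit_left: "amult unit a = a"
    and unit_right: "amult a unit = a"

locale algebra_involution =
  unital_algebra scale amult unit + involution: Vector_Spaces.linear scale scale \<tau>
  for scale :: "'k::field \<Rightarrow> 'a::ab_group_add \<Rightarrow> 'a"
    and amult :: "'a \<Rightarrow> 'a \<Rightarrow> 'a" and unit :: 'a and \<tau> :: "'a \<Rightarrow> 'a" +
  assumes involution_mult: "\<tau> (amult a b) = amult (\<tau> b) (\<tau> a)"
    and involution_involutive: "\<tau> (\<tau> a) = a"

locale strong_involution = algebra_involution +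
  assumes trace_scalar: "\<exists>c. a + \<tau> a = scale c unit"
    and norm_scalar: "\<exists>c. amult a (\<tau> a) = scale c unit"

text \<open>A pair \<open>(a, b)\<close> stands for $a + vb$.\<close>

definition cayley_dickson_mult ::
  "('k \<Rightarrow> 'a \<Rightarrow> 'a) \<Rightarrow> ('a \<Rightarrow> 'a \<Rightarrow> 'a) \<Rightarrow> ('a \<Rightarrow> 'a) \<Rightarrow> 'k \<Rightarrow>
    'a::ab_group_add \<times> 'a \<Rightarrow> 'a \<times> 'a \<Rightarrow> 'a \<times> 'a"
  where "cayley_dickson_mult scale amult \<tau> \<epsilon> = (\<lambda>(a, b) (c, d).
    (amult a c + scale \<epsilon> (amult d (\<tau> b)), amult (\<tau> a) d + amult c b))"

subsection \<open>Deformed group algebras\<close>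

definition cochain2 :: "('g::group_add \<Rightarrow> 'g \<Rightarrow> 'k::field) \<Rightarrow> bool"
  where "cochain2 F \<longleftrightarrow> (\<forall>g h. F g h \<noteq> 0) \<and> (\<forall>g. F 0 g = 1 \<and> F g 0 = 1)"

definition fs_scale :: "'k::field \<Rightarrow> ('g \<Rightarrow>\<^sub>0 'k) \<Rightarrow> ('g \<Rightarrow>\<^sub>0 'k)"
  where "fs_scale c a = Poly_Mapping.map ((*) c) a"

definition basis_elt :: "'g \<Rightarrow> ('g \<Rightarrow>\<^sub>0 'k::field)"
  where "basis_elt g = Poly_Mapping.single g 1"

definition deformed_mult ::
  "('g::group_add \<Rightarrow> 'g \<Rightarrow> 'k::field) \<Rightarrow> ('g \<Rightarrow>\<^sub>0 'k) \<Rightarrow> ('g \<Rightarrow>\<^sub>0 'k) \<Rightarrow> ('g \<Rightarrow>\<^sub>0 'k)"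
  where "deformed_mult F a b =
    (\<Sum>g\<in>Poly_Mapping.keys a. \<Sum>h\<in>Poly_Mapping.keys b.
       fs_scale (Poly_Mapping.lookup a g * Poly_Mapping.lookup b h * F g h) (basis_elt (g + h)))"

definition assoc_cocycle :: "('g::group_add \<Rightarrow> 'g \<Rightarrow> 'k::field) \<Rightarrow> 'g \<Rightarrow> 'g \<Rightarrow> 'g \<Rightarrow> 'k"
  where "assoc_cocycle F g h k = (F g h * F (g + h) k) / (F h k * F g (h + k))"

subsection \<open>Quasicrossed systems\<close>

definition field_automorphism :: "('k::field \<Rightarrow> 'k) \<Rightarrow> bool"
  where "field_automorphism f \<longleftrightarrow> bij f \<and> f 1 = 1 \<and>
    (\<forall>x y. f (x + y) = f x + f y) \<and> (\<forall>x y. f (x * y) = f x * f y)"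

definition cocycle3 :: "('g::group_add \<Rightarrow> 'g \<Rightarrow> 'g \<Rightarrow> 'k::field) \<Rightarrow> bool"
  where "cocycle3 \<phi> \<longleftrightarrow> (\<forall>g h k. \<phi> g h k \<noteq> 0) \<and> (\<forall>g h. \<phi> g 0 h = 1) \<and>
    (\<forall>g h k l. \<phi> h k l * \<phi> g (h + k) l * \<phi> g h k = \<phi> g h (k + l) * \<phi> (g + h) k l)"

definition quasicrossed_system ::
  "('g::group_add \<Rightarrow> 'g \<Rightarrow> 'g \<Rightarrow> 'k::field) \<Rightarrow> ('g \<Rightarrow> 'k \<Rightarrow> 'k) \<Rightarrow> ('g \<Rightarrow> 'g \<Rightarrow> 'k) \<Rightarrow> bool"
  where "quasicrossed_system \<phi> \<sigma> \<alpha> \<longleftrightarrow>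
    cocycle3 \<phi> \<and> (\<forall>g. field_automorphism (\<sigma> g)) \<and> (\<forall>g h. \<alpha> g h \<noteq> 0) \<and>
    (\<forall>g h x. \<sigma> g (\<sigma> h x) = \<alpha> g h * \<sigma> (g + h) x * inverse (\<alpha> g h)) \<and>
    (\<forall>g h k. \<alpha> g h * \<alpha> (g + h) k = \<phi> g h k * \<sigma> g (\<alpha> h k) * \<alpha> g (h + k)) \<and>
    (\<forall>g. \<alpha> g 0 = 1 \<and> \<alpha> 0 g = 1)"

definition corresponds_to_system ::
  "('g::group_add \<Rightarrow> 'g \<Rightarrow> 'k::field) \<Rightarrow>
    ('g \<Rightarrow> 'g \<Rightarrow> 'g \<Rightarrow> 'k) \<Rightarrow> ('g \<Rightarrow> 'k \<Rightarrow> 'k) \<Rightarrow> ('g \<Rightarrow> 'g \<Rightarrow> 'k) \<Rightarrow> bool"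
  where "corresponds_to_system F \<phi> \<sigma> \<alpha> \<longleftrightarrow>
    quasicrossed_system \<phi> \<sigma> \<alpha> \<and> \<phi> = assoc_cocycle F \<and> (\<forall>g. \<sigma> g = id) \<and> \<alpha> = F"

subsection \<open>The Cayley-Dickson algebra of a deformed group algebra\<close>

text \<open>The identification of $x$ with $(x, 0)$ and of $vx$ with $(x, 1)$, extended linearly.\<close>

definition cd_identify :: "('g \<Rightarrow>\<^sub>0 'k::field) \<times> ('g \<Rightarrow>\<^sub>0 'k) \<Rightarrow> ('g \<times> bit \<Rightarrow>\<^sub>0 'k)"
  where "cd_identify = (\<lambda>(a, b).
    (\<Sum>x\<in>Poly_Mapping.keys a. fs_scale (Poly_Mapping.lookup a x) (basis_elt (x, 0))) +
    (\<Sum>x\<in>Poly_Mapping.keys b. fs_scale (Poly_Mapping.lookup b x) (basis_elt (x, 1))))"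

text \<open>
  Under this identification the Cayley-Dickson double of the algebra deformed by \<open>F\<close> is the
  algebra deformed by \<open>F'\<close>.
\<close>

definition cayley_dickson_is_deformed ::
  "('g::ab_group_add \<Rightarrow> 'g \<Rightarrow> 'k::field) \<Rightarrow> (('g \<Rightarrow>\<^sub>0 'k) \<Rightarrow> ('g \<Rightarrow>\<^sub>0 'k)) \<Rightarrow> 'k \<Rightarrow>
    ('g \<times> bit \<Rightarrow> 'g \<times> bit \<Rightarrow> 'k) \<Rightarrow> bool"
  where "cayley_dickson_is_deformed F \<tau> \<epsilon> F' \<longleftrightarrow>
    (\<forall>p q. cd_identify (cayley_dickson_mult fs_scale (deformed_mult F) \<tau> \<epsilon> p q) =
       deformed_mult F' (cd_identify p) (cd_identify q))"

subsection \<open>Consistency of the definitions\<close>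

lemma lookup_fs_scale [simp]:
  "Poly_Mapping.lookup (fs_scale c a) x = c * Poly_Mapping.lookup a x"
  unfolding fs_scale_def by (simp add: Poly_Mapping.map.rep_eq when_def)

lemma lookup_basis_elt: "Poly_Mapping.lookup (basis_elt g) x = (if x = g then 1 else 0)"
  by (simp add: basis_elt_def lookup_single when_def)

lemma keys_basis_elt [simp]: "Poly_Mapping.keys (basis_elt g :: 'g \<Rightarrow>\<^sub>0 'k::field) = {g}"
  by (simp add: basis_elt_def)

lemma vector_space_fs_scale: "vector_space (fs_scale :: 'k::field \<Rightarrow> ('g \<Rightarrow>\<^sub>0 'k) \<Rightarrow> _)"
  by unfold_locales (auto intro!: poly_mapping_eqI simp: lookup_add algebra_simps)

lemma deformed_mult_basis_elt:
  "deformed_mult F (basis_elt g) (basis_elt h) = fs_scale (F g h) (basis_elt (g + h))"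
  by (simp add: deformed_mult_def lookup_basis_elt)

lemma deformed_mult_superset:
  assumes "finite A" "Poly_Mapping.keys a \<subseteq> A" "finite B" "Poly_Mapping.keys b \<subseteq> B"
  shows "deformed_mult F a b = (\<Sum>g\<in>A. \<Sum>h\<in>B.
    fs_scale (Poly_Mapping.lookup a g * Poly_Mapping.lookup b h * F g h) (basis_elt (g + h)))"
proof -
  have 0: "fs_scale 0 x = 0" for x :: "'a \<Rightarrow>\<^sub>0 'b"
    by (auto intro!: poly_mapping_eqI)
  show ?thesis
    unfolding deformed_mult_def using assms
    by (intro sum.mono_neutral_cong_left ballI sum.mono_neutral_left)
       (auto simp: in_keys_iff 0)
qed

lemma unital_algebra_deformed:
  assumes "cochain2 F"
  shows "unital_algebra fs_scale (deformed_mult F) (basis_elt 0)"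
proof -
  interpret vector_space "fs_scale :: 'b \<Rightarrow> ('a \<Rightarrow>\<^sub>0 'b) \<Rightarrow> _"
    by (rule vector_space_fs_scale)
  have expand: "(\<Sum>g\<in>Poly_Mapping.keys a. fs_scale (Poly_Mapping.lookup a g) (basis_elt g)) = a"
    for a :: "'a \<Rightarrow>\<^sub>0 'b"
    by (rule poly_mapping_eqI) (simp add: lookup_sum lookup_basis_elt if_distrib sum.delta' in_keys_iff
        cong: if_cong)
  show ?thesis
  proof unfold_locales
    fix a b c :: "'a \<Rightarrow>\<^sub>0 'b" and r :: 'b
    let ?U = "Poly_Mapping.keys a \<union> Poly_Mapping.keys b \<union> Poly_Mapping.keys c"
    have keys: "finite ?U" "Poly_Mapping.keys a \<subseteq> ?U" "Poly_Mapping.keys b \<subseteq> ?U"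
      "Poly_Mapping.keys c \<subseteq> ?U" "Poly_Mapping.keys (a + b) \<subseteq> ?U"
      "Poly_Mapping.keys (b + c) \<subseteq> ?U" "Poly_Mapping.keys (fs_scale r a) \<subseteq> ?U"
      "Poly_Mapping.keys (fs_scale r b) \<subseteq> ?U"
      by (auto simp: in_keys_iff lookup_add)
    note expand_mult = deformed_mult_superset[OF keys(1) _ keys(1)]
    show "deformed_mult F (a + b) c = deformed_mult F a c + deformed_mult F b c"
      by (simp only: expand_mult keys)
         (simp add: lookup_add algebra_simps sum.distrib)
    show "deformed_mult F a (b + c) = deformed_mult F a b + deformed_mult F a c"
      by (simp only: expand_mult keys)
         (simp add: lookup_add algebra_simps sum.distrib)
    show "deformed_mult F (fs_scale r a) b = fs_scale r (deformed_mult F a b)"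
      by (simp only: expand_mult keys) (simp add: scale_sum_right mult_ac)
    show "deformed_mult F a (fs_scale r b) = fs_scale r (deformed_mult F a b)"
      by (simp only: expand_mult keys) (simp add: scale_sum_right mult_ac)
    show "deformed_mult F (basis_elt 0) a = a"
      using assms expand[of a] by (simp add: deformed_mult_def lookup_basis_elt cochain2_def)
    show "deformed_mult F a (basis_elt 0) = a"
      using assms expand[of a] by (simp add: deformed_mult_def lookup_basis_elt cochain2_def)
  qed
qed

lemma corresponds_to_system_exists:
  assumes "cochain2 F"
  shows "corresponds_to_system F (assoc_cocycle F) (\<lambda>_. id) F"
  using assms
  unfolding corresponds_to_system_def quasicrossed_system_def cocycle3_def
    field_automorphism_def assoc_cocycle_def cochain2_def
  by (simp add: field_simps add.assoc)

lemma lookup_cd_identify: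
  "Poly_Mapping.lookup (cd_identify (a, b)) (x, i) =
    (if i = 0 then Poly_Mapping.lookup a x else Poly_Mapping.lookup b x)"
  by (cases i)
     (simp_all add: cd_identify_def lookup_add lookup_sum lookup_basis_elt if_distrib sum.delta' in_keys_iff
        cong: if_cong)

lemma cd_identify_basis_elt:
  "cd_identify (basis_elt x, 0) = basis_elt (x, 0)"
  "cd_identify (0, basis_elt x) = basis_elt (x, 1)"
  by (auto intro!: poly_mapping_eqI simp: lookup_cd_identify lookup_basis_elt)

end

theory Submission
  imports Defs
begin

text \<open>In a deformed group algebra the cochain is read off from products of basis elements, and
  in the natural quasicrossed system \<alpha> is that cochain. So it suffices to multiply basis
  elements in the Cayley-Dickson double: x(vy) = v(\<tau>(x)y), (vx)y = v(yx) and (vx)(vy) =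
  \<epsilon> y\<tau>(x), while x y is unchanged. Since \<tau>(x) = s(x)x, each is a multiple of one
  basis element, and as G is commutative, yx and xy are the same group element.
  \<open>cayley_dickson_cochain\<close> compares the coefficients.\<close>

lemma fs_scale_zero [simp]: "fs_scale c 0 = 0"
  by (rule poly_mapping_eqI) simp

lemma deformed_mult_zero [simp]: "deformed_mult F 0 a = 0" "deformed_mult F a 0 = 0"
  by (simp_all add: deformed_mult_def)

text \<open>Bilinearity moves the scalar out. Both sides are covered because the involution hits the
  left factor in \<tau>(a)d and the right factor in d\<tau>(b).\<close>

lemma deformed_mult_scaled_basis_elt:
  assumes "cochain2 F"
  shows "deformed_mult F (fs_scale c (basis_elt g)) (basis_elt h) =
      fs_scale (c * F g h) (basis_elt (g + h))"
    and "deformed_mult F (basis_elt g) (fs_scale c (basis_elt h)) =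
      fs_scale (c * F g h) (basis_elt (g + h))"
proof -
  interpret unital_algebra fs_scale "deformed_mult F" "basis_elt 0"
    by (rule unital_algebra_deformed[OF assms])
  show "deformed_mult F (fs_scale c (basis_elt g)) (basis_elt h) =
      fs_scale (c * F g h) (basis_elt (g + h))"
    and "deformed_mult F (basis_elt g) (fs_scale c (basis_elt h)) =
      fs_scale (c * F g h) (basis_elt (g + h))"
    by (simp_all add: mult_scale_left mult_scale_right deformed_mult_basis_elt)
qed

text \<open>A homogeneous element of the double is a pair with one zero component, so \<tau> is
  evaluated only at basis elements and at \<open>0\<close>; hence the premise
  \<open>\<tau>0\<close>.\<close>

lemma cayley_dickson_cochain:
  fixes F :: "'g::ab_group_add \<Rightarrow> 'g \<Rightarrow> 'k::field"
  assumes F: "cochain2 F"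
    and \<tau>0: "\<tau> 0 = 0"
    and \<tau>: "\<And>x. \<tau> (basis_elt x) = fs_scale (s x) (basis_elt x)"
    and deformed: "cayley_dickson_is_deformed F \<tau> \<epsilon> F'"
  shows "F' (x, 0) (y, 0) = F x y"
    and "F' (x, 0) (y, 1) = s x * F x y"
    and "F' (x, 1) (y, 0) = F y x"
    and "F' (x, 1) (y, 1) = \<epsilon> * s x * F y x"
proof -
  \<comment> \<open>Transporting the double's product along \<open>cd_identify\<close> gives F'(g,
    h) times the basis element at g + h, so its coefficient there is F'(g, h).\<close>
  have product: "Poly_Mapping.lookup
      (cd_identify (cayley_dickson_mult fs_scale (deformed_mult F) \<tau> \<epsilon> p q)) (g + h) = F' g h"
    if "cd_identify p = basis_elt g" "cd_identify q = basis_elt h" for p q g h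
    using deformed that
    by (simp add: cayley_dickson_is_deformed_def deformed_mult_basis_elt lookup_basis_elt
        \<comment> \<open>Splitting the quantified pairs would keep the hypothesis from rewriting at
          the variables \<open>p\<close> and \<open>q\<close>.\<close>
        del: split_paired_All)
  \<comment> \<open>The instance of \<open>add.commute\<close> matches the degree y + x, which
    arises when the left factor is vx, with the position x + y being read.\<close>
  note rules = cayley_dickson_mult_def \<tau>0 \<tau> deformed_mult_scaled_basis_elt[OF F]
    deformed_mult_basis_elt lookup_cd_identify lookup_basis_elt add.commute[of y x]
  show "F' (x, 0) (y, 0) = F x y"
    using product[OF cd_identify_basis_elt(1) cd_identify_basis_elt(1), of x y]
    by (simp add: rules)
  show "F' (x, 0) (y, 1) = s x * F x y"
    using product[OF cd_identify_basis_elt(1) cd_identify_basis_elt(2), of x y]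
    by (simp add: rules)
  show "F' (x, 1) (y, 0) = F y x"
    using product[OF cd_identify_basis_elt(2) cd_identify_basis_elt(1), of x y]
    by (simp add: rules)
  \<comment> \<open>Since 1 + 1 = 0 in \<open>bit\<close>, the coefficient is read in the undoubled
    component, where \<epsilon> enters.\<close>
  show "F' (x, 1) (y, 1) = \<epsilon> * s x * F y x"
    using product[OF cd_identify_basis_elt(2) cd_identify_basis_elt(2), of x y]
    by (simp add: rules mult.assoc)
qed

theorem proposition6p3:
  fixes F :: "'g::{ab_group_add, finite} \<Rightarrow> 'g \<Rightarrow> 'k::{alg_closed_field, field_char_0}"
    and s :: "'g \<Rightarrow> 'k"
    and \<tau> :: "('g \<Rightarrow>\<^sub>0 'k) \<Rightarrow> ('g \<Rightarrow>\<^sub>0 'k)"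
    and \<epsilon> :: 'k
    and F' :: "'g \<times> bit \<Rightarrow> 'g \<times> bit \<Rightarrow> 'k"
    and \<phi> :: "'g \<Rightarrow> 'g \<Rightarrow> 'g \<Rightarrow> 'k"
    and \<sigma> :: "'g \<Rightarrow> 'k \<Rightarrow> 'k"
    and \<alpha> :: "'g \<Rightarrow> 'g \<Rightarrow> 'k"
    and \<phi>' :: "'g \<times> bit \<Rightarrow> 'g \<times> bit \<Rightarrow> 'g \<times> bit \<Rightarrow> 'k"
    and \<sigma>' :: "'g \<times> bit \<Rightarrow> 'k \<Rightarrow> 'k"
    and \<alpha>' :: "'g \<times> bit \<Rightarrow> 'g \<times> bit \<Rightarrow> 'k"
  assumes "cochain2 F"
    and "\<forall>x. s x \<noteq> 0" and "s 0 = 1"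
    and "Vector_Spaces.linear fs_scale fs_scale \<tau>"
    and "\<forall>x. \<tau> (basis_elt x) = fs_scale (s x) (basis_elt x)"
    and "strong_involution fs_scale (deformed_mult F) (basis_elt 0) \<tau>"
    and "\<epsilon> \<noteq> 0"
    and "corresponds_to_system F \<phi> \<sigma> \<alpha>"
    and "cochain2 F'"
    and "cayley_dickson_is_deformed F \<tau> \<epsilon> F'"
    and "corresponds_to_system F' \<phi>' \<sigma>' \<alpha>'"
  shows "\<forall>x y.
    \<alpha>' (x, 0) (y, 0) = \<alpha> x y \<and>
    \<alpha>' (x, 0) (y, 1) = s x * \<alpha> x y \<and>
    \<alpha>' (x, 1) (y, 0) = \<alpha> y x \<and>
    \<alpha>' (x, 1) (y, 1) = \<epsilon> * s x * \<alpha> y x"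
proof -
  \<comment> \<open>Linearity supplies \<tau> 0 = 0.\<close>
  interpret \<tau>: Vector_Spaces.linear fs_scale fs_scale \<tau>
    by fact
  have "\<alpha> = F" "\<alpha>' = F'"
    using assms by (simp_all add: corresponds_to_system_def)
  then show ?thesis
    using cayley_dickson_cochain[of F \<tau> s \<epsilon> F'] \<tau>.zero assms by simp
qed

end
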